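(* For a turn $G_{a,b}$ and the adjusted turns $G_{a,b}^x$ ($x>0$), with $S_A(G_{a,b})$ denoting some Nash equilibrium strategy of player $A$ in $G_{a,b}$: (1) $\lim_{x\to0}M_A^x(G_{a,b})=M_A(G_{a,b})$; (2) $\lim_{x\to0}v_A^x(G_{a,b})=v_A(G_{a,b})$; (3) $\lim_{x\to0}S_A^x(G_{a,b})=S_A(G_{a,b})$.
   Context: All-pay bidding game. The underlying game is a two-player zero-sum game played by moving a token on an acyclic directed graph with two marked vertices $\mathcal{A}$ and $\mathcal{B}$; edges are coloured red or blue, player $A$ may move the token only along red edges and player $B$ only along blue edges. $A$ wins if the token reaches $\mathcal{A}$, $B$ wins if it reaches $\mathcal{B}$, and there are no ties. $\mathcal{S}_A(G)$ (resp. $\mathcal{S}_B(G)$) is the set of positions $A$ (resp. $B$) can move to from position $G$. $G_{a,b}$ denotes a single turn at position $G$ when $A$ holds $a$ chips and $B$ holds $b$ chips: simultaneously $A$ bids $j\in\{0,\dots,a\}$ and $B$ bids $i\in\{0,\dots,b\}$; each pays his bid to the other, so afterwards $A$ has $a-j+i$ and $B$ has $b-i+j$ chips. The higher bidder wins the bid; when bids are equal the bid is won by the player with advantage, who is the player holding more chips before the bid ($A$ if $a=b$). The bid winner decides which player makes the next move. Payoffs. $v_A(G_{a,b})\in[0,1]$ is the probability that $A$ wins under optimal play: it is $1$ at $\mathcal{A}$, $0$ at $\mathcal{B}$, and otherwise is the value of the zero-sum matrix game with the following payoff matrix. $M_A=M_A(G_{a,b})$ is the $(b+1)\times(a+1)$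 matrix, indexed from $0$, whose $(i,j)$ entry is $A$'s probability of winning after $A$ bids $j$ and $B$ bids $i$: with $p=\max_{G'\in\mathcal{S}_A(G)}v_A(G'_{a-j+i,b-i+j})$ and $q=\min_{G'\in\mathcal{S}_B(G)}v_A(G'_{a-j+i,b-i+j})$, the entry is $\max(p,q)$ if $A$ wins the bid and $\min(p,q)$ if $B$ wins the bid. Strategies. A strategy for $A$ (resp. $B$) is a probability vector with entries indexed $0,\dots,a$ (resp. $0,\dots,b$), the $i$-th entry being the probability of bidding $i$. A Nash equilibrium (= optimal) strategy is one belonging to a Nash equilibrium of the zero-sum game in which $A$'s payoff is $S_B^TM_AS_A$ when $A$ plays $S_A$ and $B$ plays $S_B$; equivalently, for $A$, one maximizing $\min_i(M_AS_A)_i$. Adjusted turn. For small $x>0$, $M_A^x(G_{a,b})=M_A(G_{a,b})+xB_{a,b}$, where $B_{a,b}$ is the $(b+1)\times(a+1)$ Toeplitz matrix with $(i,j)$ entry $a-j+i$ (the number of chips $A$ holds after the turn). $G^x_{a,b}$ is the turn with this payoff matrix for $A$, with total utility $1+(a+b)x$ split between the two players. $S_A^x(G_{a,b})$ is the strategy of $A$ that maximizes her minimum payoff under $M_A^x(G_{a,b})$, and $v_A^x(G_{a,b})$ is this payoff. The limits are taken through positive $x$. *)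

theory Defs
  imports "HOL-Analysis.Analysis"
begin

section \<open>Matrix games\<close>

text \<open>
  Matrices and vectors are indexed from 0 by functions on \<^typ>\<open>nat\<close>; the parameters \<open>m\<close>, \<open>n\<close> below
  are the largest row and column index of an \<open>(m+1) \<times> (n+1)\<close> matrix. The row player is the
  minimizing player \<open>B\<close>, the column player is the maximizing player \<open>A\<close>.
  Strategies vanish beyond the last index, so that equality of strategies is equality of vectors.
\<close>

type_synonym matrix = "nat \<Rightarrow> nat \<Rightarrow> real"

definition strategies :: "nat \<Rightarrow> (nat \<Rightarrow> real) set" where
  "strategies n = {s. (\<forall>i\<le>n. 0 \<le> s i) \<and> (\<forall>i>n. s i = 0) \<and> (\<Sum>i\<le>n. s i) = 1}"

definition expected_payoff ::
    "nat \<Rightarrow> nat \<Rightarrow> matrix \<Rightarrow> (nat \<Rightarrow> real) \<Rightarrow> (nat \<Rightarrow> real) \<Rightarrow> real" where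
  "expected_payoff m n M sA sB = (\<Sum>i\<le>m. \<Sum>j\<le>n. sB i * M i j * sA j)"

definition nash_equilibrium ::
    "nat \<Rightarrow> nat \<Rightarrow> matrix \<Rightarrow> (nat \<Rightarrow> real) \<Rightarrow> (nat \<Rightarrow> real) \<Rightarrow> bool" where
  "nash_equilibrium m n M sA sB \<longleftrightarrow>
     sA \<in> strategies n \<and> sB \<in> strategies m \<and>
     (\<forall>s\<in>strategies n. expected_payoff m n M s sB \<le> expected_payoff m n M sA sB) \<and>
     (\<forall>t\<in>strategies m. expected_payoff m n M sA sB \<le> expected_payoff m n M sA t)"

definition nash_strategy_A :: "nat \<Rightarrow> nat \<Rightarrow> matrix \<Rightarrow> (nat \<Rightarrow> real) \<Rightarrow> bool" where
  "nash_strategy_A m n M sA \<longleftrightarrow> (\<exists>sB. nash_equilibrium m n M sA sB)"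

text \<open>All equilibria of a zero-sum matrix game have the same payoff, and one exists.\<close>

definition game_value :: "nat \<Rightarrow> nat \<Rightarrow> matrix \<Rightarrow> real" where
  "game_value m n M =
     (THE v. \<exists>sA sB. nash_equilibrium m n M sA sB \<and> v = expected_payoff m n M sA sB)"

definition min_payoff :: "nat \<Rightarrow> nat \<Rightarrow> matrix \<Rightarrow> (nat \<Rightarrow> real) \<Rightarrow> real" where
  "min_payoff m n M s = Min ((\<lambda>i. \<Sum>j\<le>n. M i j * s j) ` {..m})"

definition maximin_strategy :: "nat \<Rightarrow> nat \<Rightarrow> matrix \<Rightarrow> (nat \<Rightarrow> real) \<Rightarrow> bool" where
  "maximin_strategy m n M s \<longleftrightarrow>
     s \<in> strategies n \<and> (\<forall>s'\<in>strategies n. min_payoff m n M s' \<le> min_payoff m n M s)"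

definition maximin_payoff :: "nat \<Rightarrow> nat \<Rightarrow> matrix \<Rightarrow> real" where
  "maximin_payoff m n M = (SUP s\<in>strategies n. min_payoff m n M s)"


section \<open>All-pay bidding games\<close>

text \<open>When \<open>A\<close> bids \<open>j\<close> and \<open>B\<close> bids \<open>i\<close>; a tie goes to the player with more chips, \<open>A\<close> if equal.\<close>

definition A_wins_bid :: "nat \<Rightarrow> nat \<Rightarrow> nat \<Rightarrow> nat \<Rightarrow> bool" where
  "A_wins_bid a b i j \<longleftrightarrow> j > i \<or> (j = i \<and> a \<ge> b)"

text \<open>
  \<open>red\<close> and \<open>blue\<close> are the edges along which \<open>A\<close> and \<open>B\<close> may move, so that the sets of positions
  \<open>A\<close> and \<open>B\<close> can move to from \<open>G\<close> are \<open>red `` {G}\<close> and \<open>blue `` {G}\<close>. At every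
  non-terminal position both players can move (the bid winner may hand the move to either player,
  and there are no ties). The graph may be infinite as long as only finitely many positions are
  reachable from each position, which together with acyclicity makes the backward recursion for
  the winning probabilities well-founded and its maxima and minima attained.
\<close>

locale bidding_game =
  fixes V :: "'v set" and red blue :: "('v \<times> 'v) set" and vA vB :: 'v
  assumes red_subset: "red \<subseteq> V \<times> V"
    and blue_subset: "blue \<subseteq> V \<times> V"
    and marked: "vA \<in> V" "vB \<in> V" "vA \<noteq> vB"
    and acyclic_edges: "acyclic (red \<union> blue)"
    and finite_reachable: "G \<in> V \<Longrightarrow> finite ((red \<union> blue)\<^sup>* `` {G})"
    and A_can_move: "G \<in> V - {vA, vB} \<Longrightarrow> red `` {G} \<noteq> {}"
    and B_can_move: "G \<in> V - {vA, vB} \<Longrightarrow> blue `` {G} \<noteq> {}"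
begin

lemma card_reachable_less:
  assumes "(G, G') \<in> red \<union> blue"
  shows "card ((red \<union> blue)\<^sup>* `` {G'}) < card ((red \<union> blue)\<^sup>* `` {G})"
proof (rule psubset_card_mono)
  let ?E = "red \<union> blue"
  have "G \<in> V" using assms red_subset blue_subset by blast
  then show "finite (?E\<^sup>* `` {G})" by (rule finite_reachable)
  have sub: "?E\<^sup>* `` {G'} \<subseteq> ?E\<^sup>* `` {G}"
    using assms by (auto intro: converse_rtrancl_into_rtrancl)
  have "G \<notin> ?E\<^sup>* `` {G'}"
  proof
    assume "G \<in> ?E\<^sup>* `` {G'}"
    then have "(G, G) \<in> ?E\<^sup>+" using assms by (auto intro: rtrancl_into_trancl2)
    then show False using acyclic_edges by (simp add: acyclic_def)
  qed
  with sub show "?E\<^sup>* `` {G'} \<subset> ?E\<^sup>* `` {G}" by blast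
qed

text \<open>
  Only the entries of \<open>M_A G a b\<close> with row index \<open>i \<le> b\<close> and column index \<open>j \<le> a\<close>, at a
  non-terminal \<open>G\<close>, are meaningful; there the subtractions on \<^typ>\<open>nat\<close> do not truncate.
\<close>

function v_A :: "'v \<Rightarrow> nat \<Rightarrow> nat \<Rightarrow> real" and M_A :: "'v \<Rightarrow> nat \<Rightarrow> nat \<Rightarrow> matrix" where
  "v_A G a b =
     (if G = vA then 1 else if G = vB then 0 else game_value b a (M_A G a b))"
| "M_A G a b = (\<lambda>i j.
     let p = Max ((\<lambda>G'. v_A G' (a - j + i) (b - i + j)) ` (red `` {G}));
         q = Min ((\<lambda>G'. v_A G' (a - j + i) (b - i + j)) ` (blue `` {G}))
     in if A_wins_bid a b i j then max p q else min p q)"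
  by pat_completeness auto
termination
  by (relation "Wellfounded.measure (case_sum
        (\<lambda>(G, _). 2 * card ((red \<union> blue)\<^sup>* `` {G}) + 1)
        (\<lambda>(G, _). 2 * card ((red \<union> blue)\<^sup>* `` {G})))")
     (auto dest!: card_reachable_less[OF UnI1] card_reachable_less[OF UnI2])

declare v_A.simps [simp del] M_A.simps [simp del]

definition M_A_adj :: "real \<Rightarrow> 'v \<Rightarrow> nat \<Rightarrow> nat \<Rightarrow> matrix" where
  "M_A_adj x G a b i j = M_A G a b i j + x * real (a - j + i)"

definition v_A_adj :: "real \<Rightarrow> 'v \<Rightarrow> nat \<Rightarrow> nat \<Rightarrow> real" where
  "v_A_adj x G a b = maximin_payoff b a (M_A_adj x G a b)"

text \<open>Expresses that \<open>s\<close> is \<open>A\<close>'s strategy \<open>S\<^sub>A\<^sup>x(G\<^sub>a\<^sub>,\<^sub>b)\<close> in the adjusted turn.\<close>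

definition is_S_A_adj :: "real \<Rightarrow> 'v \<Rightarrow> nat \<Rightarrow> nat \<Rightarrow> (nat \<Rightarrow> real) \<Rightarrow> bool" where
  "is_S_A_adj x G a b s \<longleftrightarrow> maximin_strategy b a (M_A_adj x G a b) s"

end

end

theory Submission
  imports Defs
begin

text \<open>
  Having more chips never hurts, so the payoffs of a turn improve for a player when the opponent
  raises his bid without changing the bid winner; the bonus makes this improvement strict. Hence a
  bid that an optimal strategy uses is a response to an opposing bid that is used as well, which
  makes the supports of optimal strategies almost initial intervals. Indifference of \<open>B\<close> between
  consecutive bids then determines the optimal strategy of \<open>A\<close>, except for finitely many \<open>x\<close>.

  For a fixed pair of supports the optimal strategies depend affinely on \<open>x\<close>. As there are finitely
  many such pairs, the optimal strategy of \<open>A\<close> is affine in \<open>x\<close> on some interval \<open>(0, \<epsilon>)\<close>, and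
  therefore converges; its limit is optimal by continuity.
\<close>

section \<open>Saddle points and the minimax theorem\<close>

text \<open>Optimality of both strategies and of the value, tested on pure bids only. The conditions
  are finitely many linear constraints, so they survive limits and, for a fixed matrix, convex
  combinations.\<close>

definition saddle_point ::
    "nat \<Rightarrow> nat \<Rightarrow> matrix \<Rightarrow> (nat \<Rightarrow> real) \<Rightarrow> (nat \<Rightarrow> real) \<Rightarrow> real \<Rightarrow> bool" where
  "saddle_point m n M p q v \<longleftrightarrow>
     p \<in> strategies n \<and> q \<in> strategies m \<and>
     (\<forall>i\<le>m. v \<le> (\<Sum>j\<le>n. M i j * p j)) \<and> (\<forall>j\<le>n. (\<Sum>i\<le>m. q i * M i j) \<le> v)"

lemma strategiesD:
  assumes "s \<in> strategies n"
  shows "0 \<le> s i" "n < i \<Longrightarrow> s i = 0" "(\<Sum>i\<le>n. s i) = 1"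
  using assms by (cases "i \<le> n"; auto simp: strategies_def)+

lemma strategies_convex:
  assumes "s \<in> strategies n" "t \<in> strategies n" "0 \<le> l" "l \<le> 1"
  shows "(\<lambda>i. (1 - l) * s i + l * t i) \<in> strategies n"
  using assms by (auto simp: strategies_def sum.distrib simp flip: sum_distrib_left)

lemma strategies_mono:
  assumes "s \<in> strategies n" "n \<le> n'"
  shows "s \<in> strategies n'"
proof -
  have "(\<Sum>i\<le>n'. s i) = (\<Sum>i\<le>n. s i)"
    using assms by (intro sum.mono_neutral_right) (auto simp: strategies_def)
  then show ?thesis using assms strategiesD[OF assms(1)] by (auto simp: strategies_def)
qed

lemma pure_strategy: "k \<le> n \<Longrightarrow> (\<lambda>i. if i = k then 1 else 0) \<in> strategies n"
  by (auto simp: strategies_def)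

lemma expected_payoff_rows:
  "expected_payoff m n M p q = (\<Sum>i\<le>m. q i * (\<Sum>j\<le>n. M i j * p j))"
  by (simp add: expected_payoff_def sum_distrib_left mult.assoc)

lemma expected_payoff_cols:
  "expected_payoff m n M p q = (\<Sum>j\<le>n. (\<Sum>i\<le>m. q i * M i j) * p j)"
  unfolding expected_payoff_def by (subst sum.swap) (simp add: sum_distrib_right)

lemma weighted_sum_ge:
  fixes f :: "nat \<Rightarrow> real"
  assumes "s \<in> strategies n" "\<And>i. i \<le> n \<Longrightarrow> v \<le> f i"
  shows "v \<le> (\<Sum>i\<le>n. s i * f i)"
proof -
  have "v = (\<Sum>i\<le>n. s i * v)" using strategiesD(3)[OF assms(1)] by (simp flip: sum_distrib_right)
  also have "\<dots> \<le> (\<Sum>i\<le>n. s i * f i)"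
    using assms strategiesD(1)[OF assms(1)] by (intro sum_mono mult_left_mono) auto
  finally show ?thesis .
qed

lemma weighted_sum_le:
  fixes f :: "nat \<Rightarrow> real"
  assumes "s \<in> strategies n" "\<And>i. i \<le> n \<Longrightarrow> f i \<le> v"
  shows "(\<Sum>i\<le>n. s i * f i) \<le> v"
  using weighted_sum_ge[of s n "- v" "\<lambda>i. - f i"] assms by (simp add: sum_negf)

lemma saddle_point_payoff_A:
  assumes "saddle_point m n M p q v" "t \<in> strategies m"
  shows "v \<le> expected_payoff m n M p t"
  unfolding expected_payoff_rows
  using assms by (intro weighted_sum_ge[of t]) (auto simp: saddle_point_def)

lemma saddle_point_payoff_B:
  assumes "saddle_point m n M p q v" "s \<in> strategies n"
  shows "expected_payoff m n M s q \<le> v"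
proof -
  have "(\<Sum>j\<le>n. s j * (\<Sum>i\<le>m. q i * M i j)) \<le> v"
    using assms by (intro weighted_sum_le[of s]) (auto simp: saddle_point_def)
  then show ?thesis by (simp add: expected_payoff_cols mult.commute)
qed

lemma saddle_point_payoff:
  assumes "saddle_point m n M p q v"
  shows "expected_payoff m n M p q = v"
  using saddle_point_payoff_A[OF assms] saddle_point_payoff_B[OF assms] assms
  by (meson antisym saddle_point_def)

lemma saddle_point_value_unique:
  assumes "saddle_point m n M p q v" "saddle_point m n M p' q' v'"
  shows "v = v'"
  using saddle_point_payoff_A[OF assms(1), of q'] saddle_point_payoff_B[OF assms(2), of p]
    saddle_point_payoff_A[OF assms(2), of q] saddle_point_payoff_B[OF assms(1), of p'] assms
  by (force simp: saddle_point_def)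

text \<open>Optimal strategies are interchangeable. This allows two optimal strategies of
  \<open>A\<close> to be compared against one and the same \<open>q\<close>.\<close>

lemma saddle_point_swap:
  assumes "saddle_point m n M p q v" "saddle_point m n M p' q' v'"
  shows "saddle_point m n M p q' v"
  using assms saddle_point_value_unique[OF assms] by (auto simp: saddle_point_def)

text \<open>Complementary slackness: the slacks of the rows are nonnegative and their
  \<open>q\<close>-average is 0, so a row of positive weight has no slack.\<close>

lemma saddle_point_tight_row:
  assumes "saddle_point m n M p q v" "q i > 0"
  shows "i \<le> m" "(\<Sum>j\<le>n. M i j * p j) = v"
proof -
  have q: "q \<in> strategies m" using assms(1) by (simp add: saddle_point_def)
  show i: "i \<le> m" using strategiesD(2)[OF q, of i] assms(2) by force
  let ?r = "\<lambda>i. \<Sum>j\<le>n. M i j * p j"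
  have nn: "0 \<le> q k * (?r k - v)" if "k \<le> m" for k
    using assms(1) that strategiesD(1)[OF q] by (auto simp: saddle_point_def)
  have "(\<Sum>i\<le>m. q i * (?r i - v)) = 0"
    using saddle_point_payoff[OF assms(1)] strategiesD(3)[OF q]
    by (simp add: expected_payoff_rows right_diff_distrib sum_subtractf flip: sum_distrib_right)
  then have "\<forall>k\<in>{..m}. q k * (?r k - v) = 0"
    using nn by (subst (asm) sum_nonneg_eq_0_iff) auto
  with i assms(2) show "?r i = v" by force
qed

lemma saddle_point_tight_col:
  assumes "saddle_point m n M p q v" "p j > 0"
  shows "j \<le> n" "(\<Sum>i\<le>m. q i * M i j) = v"
proof -
  \<comment> \<open>Transposing and negating the matrix exchanges the two players.\<close>
  have tr: "saddle_point n m (\<lambda>j i. - M i j) q p (- v)"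
    using assms(1) by (auto simp: saddle_point_def sum_negf mult.commute)
  show "j \<le> n" "(\<Sum>i\<le>m. q i * M i j) = v"
    using saddle_point_tight_row[OF tr assms(2)] by (simp_all add: sum_negf mult.commute)
qed

text \<open>The row bound \<open>v\<close> and the column bound \<open>w\<close> need not be known
  to agree: by slackness the expected payoff equals both.\<close>

lemma saddle_pointI:
  assumes p: "p \<in> strategies n" and q: "q \<in> strategies m"
    and r: "\<And>i. i \<le> m \<Longrightarrow> v \<le> (\<Sum>j\<le>n. M i j * p j)"
    and r': "\<And>i. i \<le> m \<Longrightarrow> q i > 0 \<Longrightarrow> (\<Sum>j\<le>n. M i j * p j) = v"
    and c: "\<And>j. j \<le> n \<Longrightarrow> (\<Sum>i\<le>m. q i * M i j) \<le> w"
    and c': "\<And>j. j \<le> n \<Longrightarrow> p j > 0 \<Longrightarrow> (\<Sum>i\<le>m. q i * M i j) = w"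
  shows "saddle_point m n M p q v"
proof -
  have "expected_payoff m n M p q = (\<Sum>i\<le>m. q i * v)"
    unfolding expected_payoff_rows
  proof (rule sum.cong)
    fix i assume "i \<in> {..m}"
    then show "q i * (\<Sum>j\<le>n. M i j * p j) = q i * v"
      using r' strategiesD(1)[OF q, of i] by (cases "q i = 0") auto
  qed simp
  moreover have "expected_payoff m n M p q = (\<Sum>j\<le>n. w * p j)"
    unfolding expected_payoff_cols
  proof (rule sum.cong)
    fix j assume "j \<in> {..n}"
    then show "(\<Sum>i\<le>m. q i * M i j) * p j = w * p j"
      using c' strategiesD(1)[OF p, of j] by (cases "p j = 0") auto
  qed simp
  ultimately have "v = w"
    using strategiesD(3)[OF p] strategiesD(3)[OF q]
    by (simp flip: sum_distrib_left sum_distrib_right)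
  then show ?thesis using assms by (auto simp: saddle_point_def)
qed

lemma saddle_point_imp_nash:
  assumes "saddle_point m n M p q v"
  shows "nash_equilibrium m n M p q"
  using assms saddle_point_payoff[OF assms] saddle_point_payoff_A[OF assms]
    saddle_point_payoff_B[OF assms]
  by (auto simp: nash_equilibrium_def saddle_point_def)

lemma nash_imp_saddle_point:
  assumes "nash_equilibrium m n M p q"
  shows "saddle_point m n M p q (expected_payoff m n M p q)"
proof -
  have "expected_payoff m n M p q \<le> (\<Sum>j\<le>n. M i j * p j)" if "i \<le> m" for i
  proof -
    have "expected_payoff m n M p (\<lambda>k. if k = i then 1 else 0) = (\<Sum>j\<le>n. M i j * p j)"
      using that by (simp add: expected_payoff_rows if_distrib[of "\<lambda>x. x * _"] cong: if_cong)
    then show ?thesis using assms pure_strategy[OF that] by (force simp: nash_equilibrium_def)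
  qed
  moreover have "(\<Sum>i\<le>m. q i * M i j) \<le> expected_payoff m n M p q" if "j \<le> n" for j
  proof -
    have "expected_payoff m n M (\<lambda>k. if k = j then 1 else 0) q = (\<Sum>i\<le>m. q i * M i j)"
      using that by (simp add: expected_payoff_cols if_distrib[of "\<lambda>x. _ * x"] cong: if_cong)
    then show ?thesis using assms pure_strategy[OF that] by (force simp: nash_equilibrium_def)
  qed
  ultimately show ?thesis using assms by (auto simp: saddle_point_def nash_equilibrium_def)
qed

lemma game_value_saddle_point:
  assumes "saddle_point m n M p q v"
  shows "game_value m n M = v"
  unfolding game_value_def
proof (rule the_equality)
  show "\<exists>sA sB. nash_equilibrium m n M sA sB \<and> v = expected_payoff m n M sA sB"
    using saddle_point_imp_nash[OF assms] saddle_point_payoff[OF assms] by auto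
qed (use assms nash_imp_saddle_point saddle_point_value_unique in blast)

lemma min_payoff_ge_iff: "v \<le> min_payoff m n M s \<longleftrightarrow> (\<forall>i\<le>m. v \<le> (\<Sum>j\<le>n. M i j * s j))"
  by (auto simp: min_payoff_def)

lemma min_payoff_le_value:
  assumes "saddle_point m n M p q v" "s \<in> strategies n"
  shows "min_payoff m n M s \<le> v"
proof -
  have "min_payoff m n M s \<le> expected_payoff m n M s q"
    unfolding expected_payoff_rows
    using assms(1) min_payoff_ge_iff[of "min_payoff m n M s" m n M s]
    by (intro weighted_sum_ge[of q]) (auto simp: saddle_point_def)
  then show ?thesis using saddle_point_payoff_B[OF assms] by simp
qed

lemma maximin_payoff_saddle_point:
  assumes "saddle_point m n M p q v"
  shows "maximin_payoff m n M = v"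
  unfolding maximin_payoff_def
proof (rule cSup_eq_maximum)
  have p: "p \<in> strategies n" using assms by (simp add: saddle_point_def)
  have "v \<le> min_payoff m n M p" using assms by (simp add: min_payoff_ge_iff saddle_point_def)
  then have "min_payoff m n M p = v" using min_payoff_le_value[OF assms p] by simp
  then show "v \<in> min_payoff m n M ` strategies n" using p by auto
qed (use min_payoff_le_value[OF assms] in auto)

lemma maximin_strategy_saddle_point:
  assumes "saddle_point m n M p q v" "maximin_strategy m n M s"
  shows "saddle_point m n M s q v"
proof -
  have "v \<le> min_payoff m n M p" using assms by (simp add: min_payoff_ge_iff saddle_point_def)
  also have "\<dots> \<le> min_payoff m n M s"
    using assms by (auto simp: maximin_strategy_def saddle_point_def)
  finally show ?thesis
    using assms by (auto simp: min_payoff_ge_iff saddle_point_def maximin_strategy_def)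
qed

section \<open>The minimax theorem by separation of convex sets\<close>

text \<open>A linear functional bounded below on a quadrant has nonnegative coefficients; this is
  applied to a separating functional.\<close>

lemma nonneg_slope:
  fixes g :: real
  assumes "\<And>s. 0 < s \<Longrightarrow> c \<le> k + g * s"
  shows "0 \<le> g"
proof (rule ccontr)
  assume g: "\<not> 0 \<le> g"
  define s where "s = (\<bar>k - c\<bar> + 1) / - g"
  have "0 < s" unfolding s_def using g by (intro divide_pos_pos) auto
  moreover have "g * s = - (\<bar>k - c\<bar> + 1)" using g by (simp add: s_def)
  ultimately show False using assms[of s] by linarith
qed

text \<open>The induction splits off the last function on the part of the set where it is at least \<open>v\<close>;
  the two remaining functions are combined by separating sets in the plane.\<close>

lemma convex_alternative:
  fixes U :: "(nat \<Rightarrow> real) set"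
  assumes "\<And>u w l. u \<in> U \<Longrightarrow> w \<in> U \<Longrightarrow> 0 \<le> l \<Longrightarrow> l \<le> 1 \<Longrightarrow> (\<lambda>i. (1 - l) * u i + l * w i) \<in> U"
    and "\<And>u. u \<in> U \<Longrightarrow> \<exists>i\<le>m. u i < v"
  shows "\<exists>q\<in>strategies m. \<forall>u\<in>U. (\<Sum>i\<le>m. q i * u i) \<le> v"
  using assms
proof (induction m arbitrary: U)
  case 0
  then show ?case
    by (intro bexI[OF _ pure_strategy[of 0 0]]) (auto intro: less_imp_le)
next
  case (Suc m)
  define U' where "U' = {u \<in> U. v \<le> u (Suc m)}"
  have "(\<lambda>i. (1 - l) * u i + l * w i) \<in> U'"
    if "u \<in> U'" "w \<in> U'" "0 \<le> l" "l \<le> 1" for u w l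
  proof -
    have "(1 - l) * v + l * v \<le> (1 - l) * u (Suc m) + l * w (Suc m)"
      using that by (intro add_mono mult_left_mono) (auto simp: U'_def)
    then show ?thesis using that Suc.prems(1) by (auto simp: U'_def algebra_simps)
  qed
  moreover have "\<exists>i\<le>m. u i < v" if "u \<in> U'" for u
    using Suc.prems(2)[of u] that by (auto simp: U'_def le_Suc_eq)
  ultimately obtain q where q: "q \<in> strategies m" "\<forall>u\<in>U'. (\<Sum>i\<le>m. q i * u i) \<le> v"
    using Suc.IH[of U'] by blast
  define f where "f u = ((\<Sum>i\<le>m. q i * u i), u (Suc m))" for u :: "nat \<Rightarrow> real"
  define Q where "Q = {v<..} \<times> {v..}"
  have f_comb: "f (\<lambda>i. (1 - l) * u i + l * w i) = (1 - l) *\<^sub>R f u + l *\<^sub>R f w" for u w l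
    by (auto simp: f_def sum_distrib_left sum.distrib sum_subtractf algebra_simps)
  show ?case
  proof (cases "U = {}")
    case True
    then show ?thesis using pure_strategy[of 0 "Suc m"] by auto
  next
    case False
    have "convex (f ` U)"
      unfolding convex_alt
      using Suc.prems(1) by (auto simp flip: f_comb)
    moreover have "convex Q" unfolding Q_def by (intro convex_Times) auto
    moreover have "f ` U \<inter> Q = {}"
      using q(2) by (force simp: f_def Q_def U'_def)
    moreover have "f ` U \<noteq> {}" "Q \<noteq> {}" using False by (auto simp: Q_def)
    ultimately obtain d c where d: "d \<noteq> 0" "\<forall>z\<in>f ` U. inner d z \<le> c" "\<forall>z\<in>Q. c \<le> inner d z"
      using separating_hyperplane_sets[of "f ` U" Q] by blast
    obtain \<alpha> \<beta> where ab: "d = (\<alpha>, \<beta>)" by (cases d)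
    have Q: "c \<le> \<alpha> * (v + s) + \<beta> * (v + t)" if "0 < s" "0 \<le> t" for s t
      using d(3) that by (auto simp: Q_def ab)
    have "\<alpha> \<ge> 0"
      using Q[of _ 0] by (intro nonneg_slope[of c "\<alpha> * v + \<beta> * v"]) (simp add: algebra_simps)
    have "\<beta> \<ge> 0"
      using Q[of 1] by (intro nonneg_slope[of c "\<alpha> * v + \<alpha> + \<beta> * v"]) (simp add: algebra_simps)
    have pos: "\<alpha> + \<beta> > 0"
      using d(1) \<open>\<alpha> \<ge> 0\<close> \<open>\<beta> \<ge> 0\<close> ab by (auto simp: zero_prod_def)
    \<comment> \<open>The corner \<open>(v, v)\<close> is not in \<open>Q\<close>, so it is
      approached along the diagonal.\<close>
    have c: "c \<le> (\<alpha> + \<beta>) * v"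
    proof (rule field_le_epsilon)
      fix e :: real assume "e > 0"
      then have "c \<le> \<alpha> * (v + e / (\<alpha> + \<beta>)) + \<beta> * (v + e / (\<alpha> + \<beta>))"
        using pos by (intro Q) auto
      also have "\<dots> = (\<alpha> + \<beta>) * v + (\<alpha> + \<beta>) * (e / (\<alpha> + \<beta>))" by (simp only: algebra_simps)
      also have "\<dots> = (\<alpha> + \<beta>) * v + e" using pos by simp
      finally show "c \<le> (\<alpha> + \<beta>) * v + e" .
    qed
    \<comment> \<open>The mixture \<open>q\<close> and the last index are combined in the proportion
      \<alpha> to \<beta> given by the separating functional.\<close>
    define r where "r i = (if i = Suc m then \<beta> else \<alpha> * q i) / (\<alpha> + \<beta>)" for i
    have r_sum: "(\<Sum>i\<le>Suc m. r i * u i) = (\<alpha> * (\<Sum>i\<le>m. q i * u i) + \<beta> * u (Suc m)) / (\<alpha> + \<beta>)" for u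
      by (simp add: r_def add_divide_distrib sum_distrib_left sum_divide_distrib mult.assoc)
    have "r \<in> strategies (Suc m)"
      using r_sum[of "\<lambda>_. 1"] strategiesD[OF q(1)] \<open>\<alpha> \<ge> 0\<close> \<open>\<beta> \<ge> 0\<close> pos
      by (auto simp: strategies_def r_def)
    moreover have "(\<Sum>i\<le>Suc m. r i * u i) \<le> v" if "u \<in> U" for u
    proof -
      have "\<alpha> * (\<Sum>i\<le>m. q i * u i) + \<beta> * u (Suc m) \<le> (\<alpha> + \<beta>) * v"
        using d(2) that c by (force simp: f_def ab)
      then show ?thesis unfolding r_sum using pos by (simp add: field_simps)
    qed
    ultimately show ?thesis by blast
  qed
qed

text \<open>Strategies are functions on all of \<open>nat\<close>, so compactness comes from
  Tychonoff: the coordinates beyond \<open>n\<close> range over the singleton 0.\<close>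

lemma compact_strategies: "compact (strategies n)"
proof -
  let ?B = "PiE UNIV (\<lambda>i. if i \<le> n then {0..1} else {0::real})"
  have "compactin (product_topology (\<lambda>_. euclidean) UNIV) ?B"
    by (subst compactin_PiE) auto
  then have "compact ?B" by (simp add: euclidean_product_topology)
  moreover have "closed {s :: nat \<Rightarrow> real. (\<Sum>i\<le>n. s i) = 1}"
    by (intro closed_Collect_eq continuous_intros continuous_on_product_coordinates)
  ultimately have "compact (?B \<inter> {s. (\<Sum>i\<le>n. s i) = 1})" by blast
  moreover have "strategies n = ?B \<inter> {s. (\<Sum>i\<le>n. s i) = 1}"
  proof
    have "s i \<le> 1" if "s \<in> strategies n" "i \<le> n" for s i
      using strategiesD[OF that(1)] that(2) member_le_sum[of i "{..n}" s] by auto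
    then show "strategies n \<subseteq> ?B \<inter> {s. (\<Sum>i\<le>n. s i) = 1}"
      by (fastforce simp: strategies_def)
    show "?B \<inter> {s. (\<Sum>i\<le>n. s i) = 1} \<subseteq> strategies n"
      by (auto simp: strategies_def PiE_iff split: if_splits)
  qed
  ultimately show ?thesis by simp
qed

lemma continuous_min_payoff: "continuous_on A (min_payoff m n M)"
proof -
  have coord: "continuous_on A (\<lambda>s :: nat \<Rightarrow> real. s j)" for j
    by (rule continuous_on_subset[OF continuous_on_product_coordinates]) auto
  have "continuous_on A (\<lambda>s. Min ((\<lambda>i. \<Sum>j\<le>n. M i j * s j) ` {..m}))"
  proof (induction m)
    case 0
    then show ?case
      by (auto intro!: continuous_intros coord)
  next
    case (Suc m)
    have "continuous_on A (\<lambda>s. min (\<Sum>j\<le>n. M (Suc m) j * s j) (Min ((\<lambda>i. \<Sum>j\<le>n. M i j * s j) ` {..m})))"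
      by (intro continuous_intros coord Suc)
    then show ?case by (simp add: atMost_Suc)
  qed
  then show ?thesis by (simp add: min_payoff_def[abs_def])
qed

lemma maximin_strategy_exists: "\<exists>s. maximin_strategy m n M s"
proof -
  have "strategies n \<noteq> {}" using pure_strategy[of 0 n] by blast
  from continuous_attains_sup[OF compact_strategies this continuous_min_payoff[of _ m n M]]
  show ?thesis by (auto simp: maximin_strategy_def)
qed

text \<open>Both players take maximin strategies, \<open>B\<close> in the transposed negated game.
  As \<open>A\<close> attains \<open>v\<close>, the strict hypothesis of
  \<open>convex_alternative\<close> holds only for bounds above \<open>v\<close>; hence the detour
  through \<open>v + e\<close>.\<close>

lemma saddle_point_exists: "\<exists>p q v. saddle_point m n M p q v"
proof -
  obtain p where p: "maximin_strategy m n M p" using maximin_strategy_exists by blast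
  obtain q where q: "maximin_strategy n m (\<lambda>j i. - M i j) q" using maximin_strategy_exists by blast
  define v where "v = min_payoff m n M p"
  have "v \<le> (\<Sum>j\<le>n. M i j * p j)" if "i \<le> m" for i
    using that min_payoff_ge_iff[of v m n M p] by (auto simp: v_def)
  moreover have "(\<Sum>i\<le>m. q i * M i j) \<le> v" if j: "j \<le> n" for j
  proof (rule field_le_epsilon)
    fix e :: real assume e: "e > 0"
    let ?row = "\<lambda>s i. \<Sum>j\<le>n. M i j * s j"
    have "\<exists>r\<in>strategies m. \<forall>u\<in>?row ` strategies n. (\<Sum>i\<le>m. r i * u i) \<le> v + e"
    proof (rule convex_alternative)
      fix u assume "u \<in> ?row ` strategies n"
      then obtain s where s: "s \<in> strategies n" "u = ?row s" by blast
      have "min_payoff m n M s < v + e" using p s(1) e by (force simp: maximin_strategy_def v_def)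
      then show "\<exists>i\<le>m. u i < v + e"
        using min_payoff_ge_iff[of "v + e" m n M s] s(2) by (auto simp: not_le)
    next
      fix u w and l :: real
      assume "u \<in> ?row ` strategies n" "w \<in> ?row ` strategies n" and l: "0 \<le> l" "l \<le> 1"
      then obtain s t where st: "s \<in> strategies n" "u = ?row s" "t \<in> strategies n" "w = ?row t"
        by blast
      have "(\<lambda>i. (1 - l) * u i + l * w i) = ?row (\<lambda>i. (1 - l) * s i + l * t i)"
        by (simp add: st sum_distrib_left sum.distrib sum_subtractf algebra_simps)
      then show "(\<lambda>i. (1 - l) * u i + l * w i) \<in> ?row ` strategies n"
        by (simp only:) (rule imageI, rule strategies_convex[OF st(1,3) l])
    qed
    then obtain r where r: "r \<in> strategies m"
      and le: "\<And>s. s \<in> strategies n \<Longrightarrow> expected_payoff m n M s r \<le> v + e"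
      by (auto simp: expected_payoff_rows)
    have "(\<Sum>i\<le>m. r i * M i k) \<le> v + e" if "k \<le> n" for k
      using le[OF pure_strategy[OF that]] that
      by (simp add: expected_payoff_cols if_distrib[of "\<lambda>x. _ * x"] cong: if_cong)
    then have "- (v + e) \<le> min_payoff n m (\<lambda>j i. - M i j) r"
      by (force simp: min_payoff_ge_iff sum_negf mult.commute)
    also have "\<dots> \<le> min_payoff n m (\<lambda>j i. - M i j) q"
      using q r by (auto simp: maximin_strategy_def)
    finally show "(\<Sum>i\<le>m. q i * M i j) \<le> v + e"
      using j by (auto simp: min_payoff_ge_iff sum_negf mult.commute)
  qed
  ultimately have "saddle_point m n M p q v"
    using p q by (auto simp: saddle_point_def maximin_strategy_def)
  then show ?thesis by blast
qed

section \<open>Matrices of bidding games\<close>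

text \<open>Raising the bid of either player by one chip, the other bid being fixed, benefits the
  opponent unless this changes the bid winner, which happens only when the bid \<open>j\<close> of \<open>A\<close>
  passes from \<open>i + c - 1\<close> to \<open>i + c\<close>, where \<open>i\<close> is the bid of \<open>B\<close>. Here \<open>c\<close> is 0 if \<open>A\<close> has
  the advantage and 1 otherwise.\<close>

locale bid_matrix =
  fixes c m n :: nat and M :: matrix
  assumes c_le_1: "c \<le> 1"
    and row_mono: "i < m \<Longrightarrow> j \<le> n \<Longrightarrow> j \<noteq> i + c \<Longrightarrow> M i j \<le> M (Suc i) j"
    and col_mono: "i \<le> m \<Longrightarrow> j < n \<Longrightarrow> Suc j \<noteq> i + c \<Longrightarrow> M i (Suc j) \<le> M i j"
begin

definition adj :: "real \<Rightarrow> matrix" where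
  "adj x i j = M i j + x * real (n - j + i)"

definition row :: "real \<Rightarrow> (nat \<Rightarrow> real) \<Rightarrow> nat \<Rightarrow> real" where
  "row x p i = (\<Sum>j\<le>n. adj x i j * p j)"

definition col :: "real \<Rightarrow> (nat \<Rightarrow> real) \<Rightarrow> nat \<Rightarrow> real" where
  "col x q j = (\<Sum>i\<le>m. q i * adj x i j)"

abbreviation opt :: "real \<Rightarrow> (nat \<Rightarrow> real) \<Rightarrow> (nat \<Rightarrow> real) \<Rightarrow> real \<Rightarrow> bool" where
  "opt x \<equiv> saddle_point m n (adj x)"

lemma opt_iff:
  "opt x p q v \<longleftrightarrow> p \<in> strategies n \<and> q \<in> strategies m \<and>
    (\<forall>i\<le>m. v \<le> row x p i) \<and> (\<forall>j\<le>n. col x q j \<le> v)"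
  by (simp add: saddle_point_def row_def col_def)

text \<open>The bonus is affine in the bids, so a strategy enters it only through its mean
  bid.\<close>

lemma row_eq:
  assumes "p \<in> strategies n"
  shows "row x p i = (\<Sum>j\<le>n. M i j * p j) + x * (real n + real i - (\<Sum>j\<le>n. real j * p j))"
proof -
  have "row x p i = (\<Sum>j\<le>n. M i j * p j + (x * (real n + real i) * p j - x * (real j * p j)))"
    unfolding row_def adj_def
    by (intro sum.cong) (auto simp: of_nat_diff algebra_simps)
  then show ?thesis using strategiesD(3)[OF assms]
    by (simp add: sum.distrib sum_subtractf right_diff_distrib flip: sum_distrib_left)
qed

lemma col_eq:
  assumes "q \<in> strategies m" "j \<le> n"
  shows "col x q j = (\<Sum>i\<le>m. q i * M i j) + x * (real n - real j + (\<Sum>i\<le>m. real i * q i))"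
proof -
  have "col x q j = (\<Sum>i\<le>m. q i * M i j + (x * (real n - real j) * q i + x * (real i * q i)))"
    unfolding col_def adj_def
    using assms(2) by (intro sum.cong) (auto simp: of_nat_diff algebra_simps)
  then show ?thesis using strategiesD(3)[OF assms(1)]
    by (simp add: sum.distrib distrib_left flip: sum_distrib_left)
qed

text \<open>Only in column \<open>i + c\<close> does the step from bid \<open>i\<close> to
  \<open>Suc i\<close> change the winner. If \<open>p\<close> gives it no weight, every weighted
  entry of \<open>M\<close> weakly grows and the bonus adds exactly \<open>x\<close>.\<close>

lemma row_increase:
  assumes p: "p \<in> strategies n" and i: "i < m" and z: "p (i + c) = 0"
  shows "row x p i + x \<le> row x p (Suc i)"
proof -
  have "(\<Sum>j\<le>n. M i j * p j) \<le> (\<Sum>j\<le>n. M (Suc i) j * p j)"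
  proof (rule sum_mono)
    fix j assume "j \<in> {..n}"
    then show "M i j * p j \<le> M (Suc i) j * p j"
      using row_mono[OF i, of j] strategiesD(1)[OF p, of j] z
      by (cases "j = i + c") (auto intro: mult_right_mono)
  qed
  then show ?thesis by (simp add: row_eq[OF p] algebra_simps)
qed

lemma col_increase:
  assumes q: "q \<in> strategies m" and j: "j < n" and z: "\<And>i. i + c = Suc j \<Longrightarrow> q i = 0"
  shows "col x q (Suc j) + x \<le> col x q j"
proof -
  have "(\<Sum>i\<le>m. q i * M i (Suc j)) \<le> (\<Sum>i\<le>m. q i * M i j)"
  proof (rule sum_mono)
    fix i assume "i \<in> {..m}"
    then show "q i * M i (Suc j) \<le> q i * M i j"
      using col_mono[of i, OF _ j] strategiesD(1)[OF q, of i] z[of i]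
      by (cases "Suc j = i + c") (auto intro: mult_left_mono)
  qed
  then show ?thesis using j by (simp add: col_eq[OF q] algebra_simps)
qed

section \<open>Supports and uniqueness of optimal strategies\<close>

text \<open>If \<open>A\<close> never bids \<open>i + c\<close>, then \<open>B\<close> saves at
  least \<open>x\<close> by bidding \<open>i\<close> instead of \<open>Suc i\<close>, so
  \<open>Suc i\<close> cannot be a best response.\<close>

lemma opt_B_bid_supported:
  assumes "opt x p q v" "0 < x" "q (Suc i) > 0"
  shows "p (i + c) > 0"
proof (rule ccontr)
  assume "\<not> p (i + c) > 0"
  moreover have p: "p \<in> strategies n" using assms(1) by (simp add: opt_iff)
  ultimately have "p (i + c) = 0" using strategiesD(1)[OF p, of "i + c"] by linarith
  moreover have "Suc i \<le> m" "row x p (Suc i) = v"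
    using saddle_point_tight_row[OF assms(1,3)] by (auto simp: row_def)
  moreover from this have "v \<le> row x p i" using assms(1) by (auto simp: opt_iff)
  ultimately show False using row_increase[OF p, of i x] assms(2) by auto
qed

text \<open>The mirror image: a positive bid of \<open>A\<close> is worth its cost only if
  \<open>B\<close> uses the bid that it newly beats.\<close>

lemma opt_A_bid_supported:
  assumes "opt x p q v" "0 < x" "p (Suc j) > 0"
  shows "\<exists>i. i + c = Suc j \<and> q i > 0"
proof (rule ccontr)
  assume "\<nexists>i. i + c = Suc j \<and> q i > 0"
  moreover have q: "q \<in> strategies m" using assms(1) by (simp add: opt_iff)
  ultimately have "q i = 0" if "i + c = Suc j" for i
    using strategiesD(1)[OF q, of i] that by force
  moreover have "Suc j \<le> n" "col x q (Suc j) = v"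
    using saddle_point_tight_col[OF assms(1,3)] by (auto simp: col_def)
  moreover from this have "col x q j \<le> v" using assms(1) by (auto simp: opt_iff)
  ultimately show False using col_increase[OF q, of j x] assms(2) by auto
qed

text \<open>If \<open>p \<noteq> p'\<close>, subtract from \<open>p'\<close> the largest multiple of \<open>p\<close> that leaves it nonnegative. The
  remainder vanishes at some \<open>j \<in> D\<close>, which rules out indifference between the two corresponding
  rows.\<close>

lemma indifferent_strategies_eq_aux:
  assumes x: "0 < x" and p: "p \<in> strategies n" and p': "p' \<in> strategies n"
    and out: "\<And>j. j \<notin> insert e D \<Longrightarrow> p j = 0 \<and> p' j = 0"
    and pos: "\<And>j. j \<in> D \<Longrightarrow> p j > 0"
    and rows: "\<And>j. j \<in> D \<Longrightarrow>
      \<exists>i<m. j = i + c \<and> row x p i = row x p (Suc i) \<and> row x p' i = row x p' (Suc i)"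
    and e: "p e \<le> p' e"
  shows "p = p'"
proof (rule ccontr)
  assume "p \<noteq> p'"
  have fin: "finite D"
  proof (rule finite_subset)
    show "D \<subseteq> {..n}" using pos strategiesD(2)[OF p] by (force simp: not_le[symmetric])
  qed simp
  \<comment> \<open>Outside \<open>D\<close> only \<open>e\<close> can carry weight, and there
    \<open>p\<close> is at most \<open>p'\<close>. As both total masses are 1, \<open>p'\<close>
    must fall below \<open>p\<close> somewhere in \<open>D\<close>; this makes the ratio
    \<open>l\<close> smaller than 1.\<close>
  have "\<exists>j\<in>D. p' j < p j"
  proof (rule ccontr)
    assume "\<not> (\<exists>j\<in>D. p' j < p j)"
    then have le: "p j \<le> p' j" for j using out[of j] e by (cases "j \<in> insert e D") auto
    have "p j = p' j" if "j \<le> n" for j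
    proof (rule ccontr)
      assume "p j \<noteq> p' j"
      then have "(\<Sum>j\<le>n. p j) < (\<Sum>j\<le>n. p' j)"
        using le that by (intro sum_strict_mono_ex1) (auto intro!: bexI[of _ j] simp: order.strict_iff_order)
      then show False using strategiesD(3)[OF p] strategiesD(3)[OF p'] by simp
    qed
    then have "p j = p' j" for j
      using strategiesD(2)[OF p, of j] strategiesD(2)[OF p', of j] by (cases "j \<le> n") auto
    then show False using \<open>p \<noteq> p'\<close> by blast
  qed
  then obtain k where k: "k \<in> D" "p' k < p k" by blast
  define l where "l = Min ((\<lambda>j. p' j / p j) ` D)"
  have l_le: "l \<le> p' j / p j" if "j \<in> D" for j unfolding l_def using fin that by (intro Min_le) auto
  have "l \<in> (\<lambda>j. p' j / p j) ` D" unfolding l_def using fin k by (intro Min_in) auto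
  then obtain j where j: "j \<in> D" "l = p' j / p j" by blast
  have "p' k / p k < 1" using k(2) pos[OF k(1)] by simp
  with l_le[OF k(1)] have "l < 1" by linarith
  have "0 \<le> l" using j strategiesD(1)[OF p'] strategiesD(1)[OF p] by simp
  \<comment> \<open>The normalized remainder is again a strategy and inherits the equal rows, but it
    vanishes at the minimizing index, contradicting \<open>row_increase\<close>.\<close>
  define w where "w j = (p' j - l * p j) / (1 - l)" for j
  have "l * p j \<le> p' j" for j
  proof (cases "j \<in> D")
    case True
    then show ?thesis using l_le[of j] pos[of j] by (simp add: field_simps)
  next
    case False
    have "l * p j \<le> p j" using \<open>l < 1\<close> \<open>0 \<le> l\<close> strategiesD(1)[OF p] by (simp add: mult_left_le_one_le)
    then show ?thesis using False out[of j] e by (cases "j = e") auto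
  qed
  moreover have "(\<Sum>j\<le>n. w j) = 1"
    using strategiesD(3)[OF p] strategiesD(3)[OF p'] \<open>l < 1\<close>
    by (simp add: w_def sum_subtractf flip: sum_divide_distrib sum_distrib_left)
  ultimately have w: "w \<in> strategies n"
    using \<open>l < 1\<close> strategiesD(2)[OF p] strategiesD(2)[OF p'] by (auto simp: strategies_def w_def)
  have row_w: "row x w i = (row x p' i - l * row x p i) / (1 - l)" for i
    by (simp add: row_def w_def sum_distrib_left sum_divide_distrib flip: sum_subtractf)
       (simp add: algebra_simps)
  obtain i where i: "i < m" "j = i + c" "row x w i = row x w (Suc i)"
    using rows[OF j(1)] row_w by auto
  have "w (i + c) = 0" using j pos[OF j(1)] i(2) by (simp add: w_def)
  then show False using row_increase[OF w i(1), of x] i(3) x by simp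
qed

text \<open>Consecutive bids used by \<open>q\<close> give rows tight for both strategies. One
  coordinate \<open>e\<close> needs no equation because the total mass is fixed; the strategy that
  is smaller at \<open>e\<close> is the one subtracted.\<close>

lemma indifferent_strategies_eq:
  assumes x: "0 < x" and opt: "opt x p q v" "opt x p' q v"
    and out: "\<And>j. j \<notin> insert e D \<Longrightarrow> p j = 0 \<and> p' j = 0"
    and D: "\<And>j. j \<in> D \<Longrightarrow> \<exists>i. j = i + c \<and> q i > 0 \<and> q (Suc i) > 0"
  shows "p = p'"
proof -
  have rows: "\<exists>i<m. j = i + c \<and> row x p i = row x p (Suc i) \<and> row x p' i = row x p' (Suc i)"
    and pos: "p j > 0" "p' j > 0" if j: "j \<in> D" for j
  proof -
    obtain i where i: "j = i + c" "q i > 0" "q (Suc i) > 0" using D[OF j] by blast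
    then show "p j > 0" "p' j > 0"
      using opt_B_bid_supported[OF opt(1) x] opt_B_bid_supported[OF opt(2) x] by simp_all
    show "\<exists>i<m. j = i + c \<and> row x p i = row x p (Suc i) \<and> row x p' i = row x p' (Suc i)"
      using i saddle_point_tight_row[OF opt(1) i(2)] saddle_point_tight_row[OF opt(2) i(2)]
        saddle_point_tight_row[OF opt(1) i(3)] saddle_point_tight_row[OF opt(2) i(3)]
      by (intro exI[of _ i]) (simp add: row_def Suc_le_eq)
  qed
  have s: "p \<in> strategies n" "p' \<in> strategies n" using opt by (auto simp: opt_iff)
  show ?thesis
  proof (cases "p e \<le> p' e")
    case True
    show ?thesis by (rule indifferent_strategies_eq_aux[OF x s out pos(1) rows True])
  next
    case False
    have "p' = p"
    proof (rule indifferent_strategies_eq_aux[OF x s(2,1)])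
      show "p' j = 0 \<and> p j = 0" if "j \<notin> insert e D" for j using out[OF that] by blast
      show "p' j > 0" if "j \<in> D" for j using pos(2)[OF that] .
      show "\<exists>i<m. j = i + c \<and> row x p' i = row x p' (Suc i) \<and> row x p i = row x p (Suc i)"
        if "j \<in> D" for j using rows[OF that] by blast
      show "p' e \<le> p e" using False by simp
    qed
    then show ?thesis by simp
  qed
qed

text \<open>Here \<open>q\<close> has \<open>L\<close> positive entries, subject to \<open>L\<close> indifference equations and the
  normalization. This overdetermined system is solvable for at most one \<open>x\<close>.\<close>

definition degenerate :: "real \<Rightarrow> nat \<Rightarrow> bool" where
  "degenerate x L \<longleftrightarrow> 1 \<le> L \<and> L \<le> n \<and>
     (\<exists>q\<in>strategies m. (\<forall>j<L. col x q j = col x q (Suc j)) \<and>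
        (\<forall>i. q i > 0 \<longleftrightarrow> 1 \<le> i + c \<and> i + c \<le> L))"

text \<open>Scale \<open>q\<close> by the least \<open>l\<close> with \<open>r\<close> below
  \<open>l * q\<close>; equal masses force \<open>l\<close> to be at least 1. Where \<open>r\<close>
  touches \<open>l * q\<close>, the matching indifference equations give \<open>l * x\<close> at
  most \<open>y\<close>. Exchanging the roles shows that each \<open>L\<close> admits at most one
  positive parameter.\<close>

lemma degenerate_imp_le:
  assumes "degenerate x L" "degenerate y L" "0 < x"
  shows "x \<le> y"
proof -
  obtain q where q: "q \<in> strategies m" and qc: "\<And>j. j < L \<Longrightarrow> col x q j = col x q (Suc j)"
    and qs: "\<And>i. q i > 0 \<longleftrightarrow> 1 \<le> i + c \<and> i + c \<le> L" and L: "1 \<le> L" "L \<le> n"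
    using assms(1) by (auto simp: degenerate_def)
  obtain r where r: "r \<in> strategies m" and rc: "\<And>j. j < L \<Longrightarrow> col y r j = col y r (Suc j)"
    and rs: "\<And>i. r i > 0 \<longleftrightarrow> 1 \<le> i + c \<and> i + c \<le> L"
    using assms(2) by (auto simp: degenerate_def)
  define I where "I = {i. 1 \<le> i + c \<and> i + c \<le> L}"
  have I: "finite I" "I \<noteq> {}"
    using L c_le_1 by (auto simp: I_def intro: finite_subset[of _ "{..L}"] exI[of _ "1 - c"])
  define l where "l = Max ((\<lambda>i. r i / q i) ` I)"
  have "l \<in> (\<lambda>i. r i / q i) ` I" unfolding l_def using I by (intro Max_in) auto
  then obtain k where k: "k \<in> I" "l = r k / q k" by blast
  have le: "r i \<le> l * q i" for i
  proof (cases "i \<in> I")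
    case True
    then have "r i / q i \<le> l" unfolding l_def using I by (intro Max_ge) auto
    then show ?thesis using True qs[of i] by (simp add: I_def field_simps)
  next
    case False
    then have "r i = 0" "q i = 0"
      using qs[of i] rs[of i] strategiesD(1)[OF q, of i] strategiesD(1)[OF r, of i]
      by (auto simp: I_def)
    then show ?thesis by simp
  qed
  have "(\<Sum>i\<le>m. r i) \<le> (\<Sum>i\<le>m. l * q i)" using le by (intro sum_mono) auto
  then have "1 \<le> l"
    using strategiesD(3)[OF q] strategiesD(3)[OF r] by (simp flip: sum_distrib_left)
  obtain j where j: "Suc j = k + c" "j < L" using k(1) by (cases "k + c") (auto simp: I_def)
  define N where "N i = M i (Suc j) - M i j" for i
  \<comment> \<open>Moving from column \<open>j\<close> to \<open>Suc j\<close> costs a bonus of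
    \<open>z\<close>, so indifference means that the gain in \<open>M\<close> is exactly
    \<open>z\<close>.\<close>
  have eq: "(\<Sum>i\<le>m. s i * N i) = z" if "s \<in> strategies m" "col z s j = col z s (Suc j)" for s z
    using that j(2) L(2) by (simp add: col_eq N_def right_diff_distrib sum_subtractf algebra_simps)
  have "l * x - y = (\<Sum>i\<le>m. (l * q i - r i) * N i)"
    using eq[OF q qc[OF j(2)]] eq[OF r rc[OF j(2)]]
    by (simp add: left_diff_distrib sum_subtractf mult.assoc flip: sum_distrib_left)
  \<comment> \<open>Only row \<open>k\<close> can have a positive difference \<open>N k\<close>, and
    there the weight is zero by the choice of \<open>k\<close>.\<close>
  also have "\<dots> \<le> 0"
  proof (rule sum_nonpos)
    fix i assume i: "i \<in> {..m}"
    show "(l * q i - r i) * N i \<le> 0"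
    proof (cases "i = k")
      case True
      then show ?thesis using k qs[of k] by (simp add: I_def)
    next
      case False
      then have "N i \<le> 0" using col_mono[of i j] i j L by (simp add: N_def)
      then show ?thesis using le[of i] by (simp add: mult_nonneg_nonpos)
    qed
  qed
  finally have "l * x \<le> y" by simp
  moreover have "x \<le> l * x" using \<open>1 \<le> l\<close> assms(3) by simp
  ultimately show ?thesis by simp
qed

lemma finite_degenerate: "finite {x. 0 < x \<and> (\<exists>L. degenerate x L)}"
proof (rule finite_subset)
  show "{x. 0 < x \<and> (\<exists>L. degenerate x L)} \<subseteq> (\<Union>L\<le>n. {x. 0 < x \<and> degenerate x L})"
    by (auto simp: degenerate_def)
  have "finite {x. 0 < x \<and> degenerate x L}" for L
  proof (cases "\<exists>y. 0 < y \<and> degenerate y L")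
    case True
    then obtain y where "0 < y" "degenerate y L" by blast
    then have "{x. 0 < x \<and> degenerate x L} \<subseteq> {y}"
      by (auto intro!: antisym degenerate_imp_le)
    then show ?thesis by (rule finite_subset) simp
  next
    case False
    then have "{x. 0 < x \<and> degenerate x L} = {}" by blast
    then show ?thesis by (simp only: finite.emptyI)
  qed
  then show "finite (\<Union>L\<le>n. {x. 0 < x \<and> degenerate x L})" by blast
qed

text \<open>Let \<open>L\<close> be the largest bid used by \<open>p\<close> or \<open>p'\<close>.
  All bids from 1 to \<open>L\<close> are then used by \<open>p\<close> or \<open>p'\<close>, and
  \<open>q\<close> uses every \<open>i\<close> with \<open>i + c\<close> between 1 and
  \<open>L\<close>. Further bids of \<open>q\<close> can only have \<open>i + c\<close> equal to 0
  or \<open>Suc L\<close>. In each case there are enough indifferences for uniqueness, or the turn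
  is degenerate.\<close>

lemma opt_unique_or_degenerate:
  assumes x: "0 < x" and opt: "opt x p q v" "opt x p' q v"
  shows "p = p' \<or> (\<exists>L. degenerate x L)"
proof -
  have s: "p \<in> strategies n" "p' \<in> strategies n" "q \<in> strategies m" using opt by (auto simp: opt_iff)
  have nn: "0 \<le> p j" "0 \<le> p' j" for j using s strategiesD(1) by blast+
  define J where "J = {j. p j > 0 \<or> p' j > 0}"
  have J_iff: "j \<notin> J \<longleftrightarrow> p j = 0 \<and> p' j = 0" for j using nn[of j] by (auto simp: J_def)
  have J: "finite J" "J \<noteq> {}"
  proof -
    have "J \<subseteq> {..n}"
      unfolding J_def using strategiesD(2)[OF s(1)] strategiesD(2)[OF s(2)]
      by (force simp: not_le[symmetric])
    then show "finite J" by (rule finite_subset) simp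
    show "J \<noteq> {}"
    proof
      assume "J = {}"
      then have "(\<Sum>j\<le>n. p j) = 0" using J_iff by simp
      then show False using strategiesD(3)[OF s(1)] by simp
    qed
  qed
  have J_tight: "j \<le> n \<and> col x q j = v" if "j \<in> J" for j
    using that saddle_point_tight_col[OF opt(1), of j] saddle_point_tight_col[OF opt(2), of j]
    by (auto simp: J_def col_def)
  have J_supp: "\<exists>i. i + c = Suc j \<and> q i > 0" if "Suc j \<in> J" for j
    using that opt_A_bid_supported[OF opt(1) x] opt_A_bid_supported[OF opt(2) x]
    by (auto simp: J_def)
  define L where "L = Max J"
  have L: "L \<in> J" "\<And>j. j \<in> J \<Longrightarrow> j \<le> L" using J by (auto simp: L_def)
  \<comment> \<open>Descending from \<open>L\<close>, the two support lemmas alternate: a used bid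
    of \<open>A\<close> needs a bid of \<open>B\<close>, which needs the next lower bid of
    \<open>A\<close>.\<close>
  have "j \<in> J \<and> (\<exists>i. i + c = j \<and> q i > 0)" if "1 \<le> j" "j \<le> L" for j
    using that(2,1)
  proof (induction rule: inc_induct)
    case base
    then show ?case using L(1) J_supp[of "L - 1"] by auto
  next
    case (step k)
    then obtain i where i: "i + c = Suc k" "q i > 0" by auto
    with step.prems c_le_1 obtain i' where "i = Suc i'" "i' + c = k" by (cases i) auto
    then have "k \<in> J" using opt_B_bid_supported[OF opt(1) x, of i'] i by (auto simp: J_def)
    then show ?case using J_supp[of "k - 1"] step.prems by auto
  qed
  then have low: "\<And>j. 1 \<le> j \<Longrightarrow> j \<le> L \<Longrightarrow> j \<in> J"
    and supp: "\<And>i. 1 \<le> i + c \<Longrightarrow> i + c \<le> L \<Longrightarrow> q i > 0"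
    by (blast, metis add_right_cancel)
  have supp_le: "i + c \<le> Suc L" if "q i > 0" for i
  proof (cases i)
    case (Suc i')
    then have "i' + c \<in> J" using opt_B_bid_supported[OF opt(1) x, of i'] that by (auto simp: J_def)
    then show ?thesis using L(2) Suc by fastforce
  qed (use c_le_1 in simp)
  note uniq = indifferent_strategies_eq[OF x opt]
  show ?thesis
  \<comment> \<open>An additional top bid of \<open>B\<close> gives equations at 1 to
    \<open>L\<close>, leaving coordinate 0 to the normalization.\<close>
  proof (cases "\<exists>i. q i > 0 \<and> i + c = Suc L")
    case True
    then have supp': "q i > 0" if "1 \<le> i + c" "i + c \<le> Suc L" for i
      using supp[of i] that by (metis add_right_cancel le_SucE)
    have "p = p'"
    proof (rule uniq)
      show "p j = 0 \<and> p' j = 0" if "j \<notin> insert 0 {1..L}" for j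
        using that L(2)[of j] J_iff[of j] by force
      show "\<exists>i. j = i + c \<and> q i > 0 \<and> q (Suc i) > 0" if "j \<in> {1..L}" for j
        using that supp' c_le_1 by (intro exI[of _ "j - c"]) auto
    qed
    then show ?thesis ..
  next
    case top: False
    show ?thesis
    \<comment> \<open>An additional bottom bid, possible only for \<open>c = 0\<close>, gives
      equations at 0 to \<open>L - 1\<close>, leaving coordinate \<open>L\<close>.\<close>
    proof (cases "\<exists>i. q i > 0 \<and> i + c = 0")
      case True
      then have supp': "q i > 0" if "i + c \<le> L" for i
        using supp[of i] that by (cases "i + c = 0") auto
      have "p = p'"
      proof (rule uniq)
        show "p j = 0 \<and> p' j = 0" if "j \<notin> insert L {..<L}" for j
          using that L(2)[of j] J_iff[of j] by force
        show "\<exists>i. j = i + c \<and> q i > 0 \<and> q (Suc i) > 0" if "j \<in> {..<L}" for j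
          using that True supp' by (intro exI[of _ j]) auto
      qed
      then show ?thesis ..
    next
      case bot: False
      consider "0 \<notin> J" | "0 \<in> J" "L = 0" | "0 \<in> J" "1 \<le> L" by linarith
      then show ?thesis
      proof cases
        case 1
        have "p = p'"
        proof (rule uniq)
          show "p j = 0 \<and> p' j = 0" if "j \<notin> insert L {1..<L}" for j
            using that L(2)[of j] J_iff[of j] 1 by (cases "j = 0") force+
          show "\<exists>i. j = i + c \<and> q i > 0 \<and> q (Suc i) > 0" if "j \<in> {1..<L}" for j
            using that supp c_le_1 by (intro exI[of _ "j - c"]) auto
        qed
        then show ?thesis ..
      next
        case 2
        have "p = p'"
        proof (rule uniq)
          show "p j = 0 \<and> p' j = 0" if "j \<notin> insert 0 {}" for j
            using that L(2)[of j] J_iff[of j] 2 by force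
        qed simp
        then show ?thesis ..
      next
        case 3
        \<comment> \<open>All \<open>Suc L\<close> columns are tight while \<open>q\<close> has only
          \<open>L\<close> positive entries: the degenerate case.\<close>
        have all: "j \<in> J" if "j \<le> L" for j using low[of j] 3 that by (cases "j = 0") auto
        have "degenerate x L"
          unfolding degenerate_def
        proof (intro conjI bexI[of _ q] allI impI)
          show "1 \<le> L" by fact
          show "L \<le> n" using J_tight L(1) by blast
          show "col x q j = col x q (Suc j)" if "j < L" for j
            using J_tight[OF all, of j] J_tight[OF all, of "Suc j"] that by simp
          show "(q i > 0) = (1 \<le> i + c \<and> i + c \<le> L)" for i
            using supp[of i] supp_le[of i] top bot by (metis le_SucE not_one_le_zero less_one not_less)
        qed fact
        then show ?thesis by blast
      qed
    qed
  qed
qed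

text \<open>Every \<open>x\<close> below the finitely many degenerate parameters works. Equilibria
  with different \<open>q\<close> are first brought to a common \<open>q\<close> by
  interchangeability.\<close>

lemma eventually_opt_unique:
  "\<forall>\<^sub>F x in at_right 0. \<forall>p p' q q' v v'. opt x p q v \<longrightarrow> opt x p' q' v' \<longrightarrow> p = p'"
proof -
  let ?F = "{x. 0 < x \<and> (\<exists>L. degenerate x L)}"
  have "\<forall>\<^sub>F x in at_right 0. \<forall>y\<in>?F. x < y"
  proof (rule eventually_ball_finite[OF finite_degenerate], rule ballI)
    fix y assume "y \<in> ?F"
    then have "0 < y" by simp
    then show "\<forall>\<^sub>F x in at_right 0. x < y" by (auto simp: eventually_at_right_field)
  qed
  then show ?thesis
    using eventually_at_right_less[of "0::real"]
  proof eventually_elim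
    case (elim x)
    then have "\<nexists>L. degenerate x L" by blast
    show ?case
    proof (intro allI impI)
      fix p p' q q' v v' assume o: "opt x p q v" "opt x p' q' v'"
      have "opt x p' q v"
        using saddle_point_swap[OF o(2,1)] saddle_point_value_unique[OF o] by simp
      then show "p = p'" using opt_unique_or_degenerate[OF elim(2) o(1)] \<open>\<nexists>L. degenerate x L\<close> by blast
    qed
  qed
qed

text \<open>For a strategy \<open>p\<close> of \<open>A\<close>, the bonus \<open>x\<close> enters row \<open>i\<close> as \<open>x * i\<close> plus a term independent
  of \<open>i\<close>. Hence the optimality conditions with prescribed supports are, up to the value of the
  game, linear jointly in the strategies and \<open>x\<close>.\<close>

lemma opt_interpolate:
  assumes o1: "opt x p q v" and o2: "opt y r s w"
    and supp: "\<And>j. p j > 0 \<longleftrightarrow> r j > 0" "\<And>i. q i > 0 \<longleftrightarrow> s i > 0"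
    and l: "0 \<le> l" "l \<le> 1"
  shows "\<exists>u. opt ((1 - l) * x + l * y) (\<lambda>j. (1 - l) * p j + l * r j)
                (\<lambda>i. (1 - l) * q i + l * s i) u"
proof -
  let ?z = "(1 - l) * x + l * y"
  let ?p = "\<lambda>j. (1 - l) * p j + l * r j" and ?q = "\<lambda>i. (1 - l) * q i + l * s i"
  have st: "p \<in> strategies n" "r \<in> strategies n" "q \<in> strategies m" "s \<in> strategies m"
    using o1 o2 by (auto simp: opt_iff)
  have nn: "0 \<le> p j" "0 \<le> r j" "0 \<le> q j" "0 \<le> s j" for j using st strategiesD(1) by blast+
  have p: "?p \<in> strategies n" and q: "?q \<in> strategies m" using strategies_convex st l by blast+
  have p_pos: "p j > 0 \<and> r j > 0" if "?p j > 0" for j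
    using that supp(1)[of j] nn(1,2)[of j] by (cases "p j > 0") auto
  have q_pos: "q j > 0 \<and> s j > 0" if "?q j > 0" for j
    using that supp(2)[of j] nn(3,4)[of j] by (cases "q j > 0") auto
  define mean where "mean k t = (\<Sum>j\<le>k. real j * t j)" for k and t :: "nat \<Rightarrow> real"
  \<comment> \<open>The product of \<open>x\<close> with the mean bid is not affine along the
    segment. Removing it from the values leaves quantities that interpolate affinely.\<close>
  define v1 w1 where "v1 = v - x * (n - mean n p)" and "w1 = w - y * (n - mean n r)"
  define v2 w2 where "v2 = v - x * (n + mean m q)" and "w2 = w - y * (n + mean m s)"
  have rows: "row ?z ?p i = (1 - l) * (row x p i - v + v1) + l * (row y r i - w + w1)
      + ?z * (n - mean n ?p)" for i
  proof -
    have "(\<Sum>j\<le>n. M i j * ?p j) = (1 - l) * (\<Sum>j\<le>n. M i j * p j) + l * (\<Sum>j\<le>n. M i j * r j)"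
      by (simp add: sum_distrib_left sum.distrib distrib_left mult.left_commute)
    then show ?thesis
      unfolding row_eq[OF p] row_eq[OF st(1)] row_eq[OF st(2)] v1_def w1_def mean_def
      by (simp only:) (simp add: algebra_simps)
  qed
  have cols: "col ?z ?q j = (1 - l) * (col x q j - v + v2) + l * (col y s j - w + w2)
      + ?z * (n + mean m ?q)" if "j \<le> n" for j
  proof -
    have "(\<Sum>i\<le>m. ?q i * M i j) = (1 - l) * (\<Sum>i\<le>m. q i * M i j) + l * (\<Sum>i\<le>m. s i * M i j)"
      by (simp add: sum_distrib_left sum.distrib distrib_right mult.assoc)
    then show ?thesis
      unfolding col_eq[OF q that] col_eq[OF st(3) that] col_eq[OF st(4) that] v2_def w2_def mean_def
      by (simp only:) (simp add: algebra_simps)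
  qed
  have "opt ?z ?p ?q ((1 - l) * v1 + l * w1 + ?z * (n - mean n ?p))"
  \<comment> \<open>Rows and columns yield the value in two different forms, which
    \<open>saddle_pointI\<close> reconciles.\<close>
  proof (rule saddle_pointI[OF p q, where M = "adj ?z", folded row_def col_def])
    fix i assume i: "i \<le> m"
    have "v1 \<le> row x p i - v + v1" "w1 \<le> row y r i - w + w1" using o1 o2 i by (auto simp: opt_iff)
    then show "(1 - l) * v1 + l * w1 + ?z * (n - mean n ?p) \<le> row ?z ?p i"
      unfolding rows using l by (intro add_right_mono add_mono mult_left_mono) auto
    assume "?q i > 0"
    then have "row x p i = v" "row y r i = w"
      using q_pos saddle_point_tight_row(2) o1 o2 unfolding row_def by blast+
    then show "row ?z ?p i = (1 - l) * v1 + l * w1 + ?z * (n - mean n ?p)"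
      unfolding rows by simp
  next
    fix j assume j: "j \<le> n"
    have "col x q j - v + v2 \<le> v2" "col y s j - w + w2 \<le> w2" using o1 o2 j by (auto simp: opt_iff)
    then show "col ?z ?q j \<le> (1 - l) * v2 + l * w2 + ?z * (n + mean m ?q)"
      unfolding cols[OF j] using l by (intro add_right_mono add_mono mult_left_mono) auto
    assume "?p j > 0"
    then have "col x q j = v" "col y s j = w"
      using p_pos saddle_point_tight_col(2) o1 o2 unfolding col_def by blast+
    then show "col ?z ?q j = (1 - l) * v2 + l * w2 + ?z * (n + mean m ?q)"
      unfolding cols[OF j] by simp
  qed
  then show ?thesis by blast
qed

section \<open>Convergence of the optimal strategy\<close>

lemma opt_family:
  obtains P Q W where "\<And>x. opt x (P x) (Q x) (W x)"
proof -
  have "\<forall>x. \<exists>p q v. opt x p q v" using saddle_point_exists by blast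
  then have "\<exists>P Q W. \<forall>x. opt x (P x) (Q x) (W x)" by (simp only: choice_iff)
  then show thesis using that by blast
qed

lemma opt_A_strategy_tendsto:
  "\<exists>S. \<forall>Sx. (\<forall>\<^sub>F x in at_right 0. \<exists>q v. opt x (Sx x) q v)
      \<longrightarrow> (\<forall>j. ((\<lambda>x. Sx x j) \<longlongrightarrow> S j) (at_right 0))"
proof -
  obtain e where e: "0 < e"
    and uniq: "\<And>x p p' q q' v v'. 0 < x \<Longrightarrow> x < e \<Longrightarrow> opt x p q v \<Longrightarrow> opt x p' q' v' \<Longrightarrow> p = p'"
    using eventually_opt_unique unfolding eventually_at_right_field by metis
  obtain P Q W where P: "\<And>x. opt x (P x) (Q x) (W x)" by (rule opt_family) blast
  define supports where "supports p q = ({j. p j > 0}, {i. q i > 0})" for p q :: "nat \<Rightarrow> real"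
  define F where "F = Pow {..n} \<times> Pow {..m}"
  have F: "supports (P x) (Q x) \<in> F" for x
    using saddle_point_tight_row(1)[OF P] saddle_point_tight_col(1)[OF P]
    by (auto simp: supports_def F_def)
  have "\<exists>T. \<exists>\<^sub>F x in at_right 0. supports (P x) (Q x) = T"
  proof (rule ccontr)
    assume "\<nexists>T. \<exists>\<^sub>F x in at_right 0. supports (P x) (Q x) = T"
    then have "\<forall>\<^sub>F x in at_right 0. \<forall>T\<in>F. supports (P x) (Q x) \<noteq> T"
      by (intro eventually_ball_finite) (auto simp: F_def frequently_def)
    then have "\<forall>\<^sub>F x in at_right (0::real). False" by (rule eventually_mono) (use F in blast)
    then show False by simp
  qed
  \<comment> \<open>By finiteness some pair of supports recurs arbitrarily close to 0.\<close>
  then obtain T where T: "\<exists>\<^sub>F x in at_right 0. supports (P x) (Q x) = T" by blast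
  have ex_T: "\<exists>x>0. x < d \<and> supports (P x) (Q x) = T" if "0 < d" for d
  proof (rule ccontr)
    assume "\<not> (\<exists>x>0. x < d \<and> supports (P x) (Q x) = T)"
    then have "\<forall>\<^sub>F x in at_right 0. supports (P x) (Q x) \<noteq> T"
      using that by (auto simp: eventually_at_right_field)
    then show False using T by (simp add: frequently_def)
  qed
  obtain z where z: "0 < z" "z < e" "supports (P z) (Q z) = T" using ex_T[OF e] by blast
  have comb: "\<exists>r u. opt ((1 - l) * x + l * z) (\<lambda>j. (1 - l) * p j + l * P z j) r u
      \<and> supports (\<lambda>j. (1 - l) * p j + l * P z j) r = T"
    if o: "opt x p q v" "supports p q = T" and l: "0 \<le> l" "l \<le> 1" for x p q v l
  proof -
    let ?r = "\<lambda>i. (1 - l) * q i + l * Q z i"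
    have supp: "p j > 0 \<longleftrightarrow> P z j > 0" "q j > 0 \<longleftrightarrow> Q z j > 0" for j
      using o(2) z(3) by (auto simp: supports_def set_eq_iff)
    have nn: "0 \<le> p j" "0 \<le> q j" "0 \<le> P z j" "0 \<le> Q z j" for j
      using o(1) P[of z] strategiesD(1) by (auto simp: opt_iff)
    have pos: "(1 - l) * s + l * t > 0 \<longleftrightarrow> s > 0" if "0 \<le> s" "0 \<le> t" "s > 0 \<longleftrightarrow> t > 0" for s t :: real
      using that l by (cases "s > 0"; cases "l = 1") (auto intro: add_pos_nonneg)
    have "supports (\<lambda>j. (1 - l) * p j + l * P z j) ?r = supports p q"
      using nn supp by (simp add: supports_def pos)
    then show ?thesis using opt_interpolate[OF o(1) P supp l] o(2) by auto
  qed
  \<comment> \<open>Interpolating between \<open>z\<close> and a parameter \<open>y\<close> below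
    \<open>x\<close> with supports \<open>T\<close> gives an optimal pair at \<open>x\<close>.
    Uniqueness identifies its first component with \<open>P x\<close>; the partner \<open>q\<close>
    need not be \<open>Q x\<close>.\<close>
  have typed: "\<exists>q v. opt x (P x) q v \<and> supports (P x) q = T" if x: "0 < x" "x < z" for x
  proof -
    obtain y where y: "0 < y" "y < x" "supports (P y) (Q y) = T" using ex_T x by blast
    define l where "l = (x - y) / (z - y)"
    have l: "0 \<le> l" "l \<le> 1" using x y by (auto simp: l_def)
    have "(1 - l) * y + l * z = y + l * (z - y)" by (simp add: algebra_simps)
    also have "\<dots> = x" using x y by (simp add: l_def)
    finally have lx: "(1 - l) * y + l * z = x" .
    obtain r u where r: "opt x (\<lambda>j. (1 - l) * P y j + l * P z j) r u"
      "supports (\<lambda>j. (1 - l) * P y j + l * P z j) r = T"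
      using comb[OF P y(3) l] unfolding lx by blast
    then have "(\<lambda>j. (1 - l) * P y j + l * P z j) = P x"
      using uniq[OF x(1) _ r(1) P] x z by simp
    then show ?thesis using r by auto
  qed
  define y where "y = z / 2"
  have y: "0 < y" "y < z" using z by (auto simp: y_def)
  \<comment> \<open>The point \<open>y\<close> is a convex combination of \<open>x\<close> and
    \<open>z\<close>; solving the interpolation formula for \<open>P x\<close> gives the line
    through the points at \<open>y\<close> and \<open>z\<close>.\<close>
  have affine: "((z - x) * P y j - (y - x) * P z j) / (z - y) = P x j" if x: "0 < x" "x < y" for x j
  proof -
    define l where "l = (y - x) / (z - x)"
    have l: "0 \<le> l" "l \<le> 1" using x y by (auto simp: l_def)
    have "(1 - l) * x + l * z = x + l * (z - x)" by (simp add: algebra_simps)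
    also have "\<dots> = y" using x y by (simp add: l_def)
    finally have lx: "(1 - l) * x + l * z = y" .
    obtain q v where q: "opt x (P x) q v" "supports (P x) q = T" using typed x y by (meson order_less_trans)
    obtain r u where r: "opt y (\<lambda>j. (1 - l) * P x j + l * P z j) r u"
      using comb[OF q l] unfolding lx by blast
    have "(\<lambda>j. (1 - l) * P x j + l * P z j) = P y"
      using uniq[OF y(1) _ r P] y z by simp
    then have Py: "P y j = (1 - l) * P x j + l * P z j" by metis
    have "(z - x) * P y j = ((z - x) - (z - x) * l) * P x j + (z - x) * l * P z j"
      unfolding Py by (simp only: algebra_simps)
    also have "(z - x) * l = y - x" using x y by (simp add: l_def)
    finally show ?thesis using y by (simp add: field_simps)
  qed
  show ?thesis
  \<comment> \<open>The witness is this line evaluated at 0, and it does not depend on the selection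
    \<open>Sx\<close>.\<close>
  proof (intro exI[of _ "\<lambda>j. (z * P y j - y * P z j) / (z - y)"] allI impI)
    fix Sx j assume Sx: "\<forall>\<^sub>F x in at_right 0. \<exists>q v. opt x (Sx x) q v"
    have "((\<lambda>x. ((z - x) * P y j - (y - x) * P z j) / (z - y)) \<longlongrightarrow>
        ((z - 0) * P y j - (y - 0) * P z j) / (z - y)) (at_right 0)"
      using y by (intro tendsto_intros) auto
    moreover have "\<forall>\<^sub>F x in at_right 0. ((z - x) * P y j - (y - x) * P z j) / (z - y) = Sx x j"
      using Sx eventually_at_right_real[OF y(1)]
    proof eventually_elim
      case (elim x)
      then obtain q v where "opt x (Sx x) q v" by blast
      then have "Sx x = P x" using uniq[of x] P elim(2) y z by force
      then show ?case using affine elim(2) by simp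
    qed
    ultimately show "((\<lambda>x. Sx x j) \<longlongrightarrow> (z * P y j - y * P z j) / (z - y)) (at_right 0)"
      by (simp add: Lim_transform_eventually)
  qed
qed

section \<open>The value and the limit strategy in the unadjusted game\<close>

lemma opt_0_iff: "opt 0 = saddle_point m n M"
proof -
  have "adj 0 = M" by (simp add: adj_def fun_eq_iff)
  then show ?thesis by simp
qed

text \<open>The bonus lies between 0 and \<open>x * (n + m)\<close>; an optimal strategy of one game
  is tested against an optimal strategy of the other.\<close>

lemma opt_value_bounds:
  assumes "opt 0 p q v" "opt x p' q' v'" "0 \<le> x"
  shows "v \<le> v'" "v' \<le> v + x * (n + m)"
proof -
  have st: "p \<in> strategies n" "p' \<in> strategies n" "q \<in> strategies m" "q' \<in> strategies m"
    using assms by (auto simp: opt_iff)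
  have "v \<le> expected_payoff m n (adj 0) p q'" using saddle_point_payoff_A assms st by blast
  also have "\<dots> \<le> expected_payoff m n (adj x) p q'"
    unfolding expected_payoff_def using assms(3) strategiesD(1)[OF st(1)] strategiesD(1)[OF st(4)]
    by (intro sum_mono mult_right_mono mult_left_mono) (auto simp: adj_def)
  also have "\<dots> \<le> v'" using saddle_point_payoff_B assms st by blast
  finally show "v \<le> v'" .
  have "v' \<le> expected_payoff m n (adj x) p' q" using saddle_point_payoff_A assms st by blast
  also have "\<dots> = (\<Sum>i\<le>m. q i * row x p' i)" by (simp add: expected_payoff_rows row_def)
  also have "\<dots> \<le> (\<Sum>i\<le>m. q i * (row 0 p' i + x * (n + m)))"
  proof (intro sum_mono mult_left_mono)
    fix i assume "i \<in> {..m}"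
    moreover have "0 \<le> (\<Sum>j\<le>n. real j * p' j)"
      using strategiesD(1)[OF st(2)] by (intro sum_nonneg) auto
    ultimately have "x * (n + i - (\<Sum>j\<le>n. real j * p' j)) \<le> x * (n + m)"
      using assms(3) by (intro mult_left_mono) auto
    then show "row x p' i \<le> row 0 p' i + x * (n + m)" by (simp add: row_eq[OF st(2)])
  qed (use strategiesD(1)[OF st(3)] in auto)
  also have "\<dots> = expected_payoff m n (adj 0) p' q + x * (n + m)"
    using strategiesD(3)[OF st(3)]
    by (simp add: expected_payoff_rows row_def distrib_left sum.distrib flip: sum_distrib_right)
  also have "\<dots> \<le> v + x * (n + m)" using saddle_point_payoff_B assms st by (intro add_right_mono) blast
  finally show "v' \<le> v + x * (n + m)" .
qed

lemma opt_value_tendsto: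
  assumes "opt 0 p q v" "\<And>x. 0 < x \<Longrightarrow> opt x (P x) (Q x) (W x)"
  shows "(W \<longlongrightarrow> v) (at_right 0)"
proof (rule tendsto_sandwich[OF _ _ tendsto_const])
  show "\<forall>\<^sub>F x in at_right 0. v \<le> W x" "\<forall>\<^sub>F x in at_right 0. W x \<le> v + x * (n + m)"
    using opt_value_bounds[OF assms(1,2)]
    by (auto intro!: eventually_mono[OF eventually_at_right_less[of "0::real"]])
  have "((\<lambda>x::real. v + x * (n + m)) \<longlongrightarrow> v + 0 * real (n + m)) (at_right 0)"
    by (intro tendsto_intros)
  then show "((\<lambda>x::real. v + x * (n + m)) \<longlongrightarrow> v) (at_right 0)" by simp
qed

lemma adj_tendsto: "((\<lambda>x. adj x i j) \<longlongrightarrow> M i j) (at_right 0)"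
proof -
  have "((\<lambda>x. adj x i j) \<longlongrightarrow> M i j + 0 * real (n - j + i)) (at_right 0)"
    unfolding adj_def by (intro tendsto_intros)
  then show ?thesis by simp
qed

lemma maximin_payoff_tendsto: "((\<lambda>x. maximin_payoff m n (adj x)) \<longlongrightarrow> game_value m n M) (at_right 0)"
proof -
  obtain p q v where o: "opt 0 p q v" using saddle_point_exists by blast
  obtain P Q W where P: "\<And>x. opt x (P x) (Q x) (W x)" by (rule opt_family) blast
  have "maximin_payoff m n (adj x) = W x" for x by (rule maximin_payoff_saddle_point[OF P])
  moreover have "game_value m n M = v"
    using game_value_saddle_point o unfolding opt_0_iff by blast
  ultimately show ?thesis using opt_value_tendsto[OF o P] by simp
qed

text \<open>The inequalities making \<open>P x\<close> optimal pass to the limit, since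
  \<open>W x\<close> tends to \<open>v\<close>. Pairing \<open>S\<close> with an optimal
  \<open>q\<close> of the unadjusted game gives an equilibrium.\<close>

lemma maximin_strategy_tendsto:
  "\<exists>S. nash_strategy_A m n M S \<and>
     (\<forall>Sx. (\<forall>\<^sub>F x in at_right 0. maximin_strategy m n (adj x) (Sx x))
        \<longrightarrow> (\<forall>j. ((\<lambda>x. Sx x j) \<longlongrightarrow> S j) (at_right 0)))"
proof -
  obtain S where S: "\<And>Sx j. (\<forall>\<^sub>F x in at_right 0. \<exists>q v. opt x (Sx x) q v)
      \<Longrightarrow> ((\<lambda>x. Sx x j) \<longlongrightarrow> S j) (at_right 0)"
    using opt_A_strategy_tendsto by blast
  obtain p q v where o: "opt 0 p q v" using saddle_point_exists by blast
  obtain P Q W where P: "\<And>x. opt x (P x) (Q x) (W x)" by (rule opt_family) blast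
  have PS: "((\<lambda>x. P x j) \<longlongrightarrow> S j) (at_right 0)" for j
    using P by (intro S always_eventually) blast
  have st: "P x \<in> strategies n" for x using P[of x] by (simp add: opt_iff)
  have "S \<in> strategies n"
    unfolding strategies_def
  proof (intro CollectI conjI allI impI)
    show "0 \<le> S i" for i
      by (rule tendsto_lowerbound[OF PS]) (use strategiesD(1)[OF st] in auto)
    show "S i = 0" if "n < i" for i
      using PS[of i] strategiesD(2)[OF st that] by (simp add: tendsto_const_iff)
    have "((\<lambda>x. \<Sum>i\<le>n. P x i) \<longlongrightarrow> (\<Sum>i\<le>n. S i)) (at_right 0)" by (intro tendsto_sum PS)
    then show "(\<Sum>i\<le>n. S i) = 1" using strategiesD(3)[OF st] by (simp add: tendsto_const_iff)
  qed
  moreover have "v \<le> row 0 S i" if "i \<le> m" for i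
  proof (rule tendsto_le[OF _ _ opt_value_tendsto[OF o P]])
    have "((\<lambda>x. row x (P x) i) \<longlongrightarrow> (\<Sum>j\<le>n. M i j * S j)) (at_right 0)"
      unfolding row_def by (intro tendsto_sum tendsto_mult adj_tendsto PS)
    then show "((\<lambda>x. row x (P x) i) \<longlongrightarrow> row 0 S i) (at_right 0)" by (simp add: row_def adj_def)
    show "\<forall>\<^sub>F x in at_right 0. W x \<le> row x (P x) i"
      using P that by (intro always_eventually) (auto simp: opt_iff)
  qed simp
  ultimately have "opt 0 S q v" using o by (simp add: opt_iff)
  then have "nash_strategy_A m n M S"
    using saddle_point_imp_nash unfolding nash_strategy_A_def opt_0_iff by blast
  moreover have "((\<lambda>x. Sx x j) \<longlongrightarrow> S j) (at_right 0)"
    if "\<forall>\<^sub>F x in at_right 0. maximin_strategy m n (adj x) (Sx x)" for Sx j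
    using that maximin_strategy_saddle_point[OF P]
    by (intro S) (auto elim!: eventually_mono)
  ultimately show ?thesis by blast
qed

end

section \<open>Monotonicity in the number of chips\<close>

context bidding_game
begin

lemma finite_moves:
  assumes "G \<in> V"
  shows "finite (red `` {G})" "finite (blue `` {G})"
  by (auto intro!: finite_subset[OF _ finite_reachable[OF assms]])

text \<open>Better successor values raise both the maximum and the minimum over moves, and winning
  the bid replaces the smaller of the two by the larger.\<close>

lemma M_A_entry_mono:
  assumes G: "G \<in> V - {vA, vB}"
    and le: "\<And>G'. (G, G') \<in> red \<union> blue \<Longrightarrow>
      v_A G' (a - j + i) (b - i + j) \<le> v_A G' (a' - j' + i') (b' - i' + j')"
    and win: "A_wins_bid a b i j \<Longrightarrow> A_wins_bid a' b' i' j'"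
  shows "M_A G a b i j \<le> M_A G a' b' i' j'"
proof -
  let ?f = "\<lambda>G'. v_A G' (a - j + i) (b - i + j)" and ?g = "\<lambda>G'. v_A G' (a' - j' + i') (b' - i' + j')"
  have ne: "red `` {G} \<noteq> {}" "blue `` {G} \<noteq> {}" using G A_can_move B_can_move by auto
  have fin: "finite (red `` {G})" "finite (blue `` {G})" using finite_moves G by auto
  have "Max (?f ` (red `` {G})) \<le> Max (?g ` (red `` {G}))"
  proof (rule Max.boundedI)
    fix y assume "y \<in> ?f ` (red `` {G})"
    then obtain G' where G': "(G, G') \<in> red" "y = ?f G'" by blast
    then have "y \<le> ?g G'" using le by blast
    also have "\<dots> \<le> Max (?g ` (red `` {G}))" using fin G' by (intro Max_ge) auto
    finally show "y \<le> Max (?g ` (red `` {G}))" .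
  qed (use fin ne in auto)
  moreover have "Min (?f ` (blue `` {G})) \<le> Min (?g ` (blue `` {G}))"
  proof (rule Min.boundedI)
    fix y assume "y \<in> ?g ` (blue `` {G})"
    then obtain G' where G': "(G, G') \<in> blue" "y = ?g G'" by blast
    have "Min (?f ` (blue `` {G})) \<le> ?f G'" using fin G' by (intro Min_le) auto
    also have "\<dots> \<le> y" using le G' by blast
    finally show "Min (?f ` (blue `` {G})) \<le> y" .
  qed (use fin ne in auto)
  ultimately show ?thesis using win by (auto simp: M_A.simps Let_def le_max_iff_disj min_le_iff_disj)
qed

text \<open>With more chips \<open>A\<close> can still play \<open>p\<close>, while the
  \<open>q'\<close> of the poorer \<open>B\<close> was available to the richer one. Playing
  \<open>p\<close> against \<open>q'\<close> in both games uses only bids that are legal in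
  both.\<close>

lemma v_A_mono:
  assumes "G \<in> V" "a \<le> a'" "a + b = a' + b'"
  shows "v_A G a b \<le> v_A G a' b'"
  using assms
proof (induction "card ((red \<union> blue)\<^sup>* `` {G})" arbitrary: G a b a' b' rule: less_induct)
  case less
  show ?case
  proof (cases "G = vA \<or> G = vB")
    case True
    then show ?thesis using marked(3) by (auto simp: v_A.simps)
  next
    case False
    obtain p q v where o: "saddle_point b a (M_A G a b) p q v" using saddle_point_exists by blast
    obtain p' q' v' where o': "saddle_point b' a' (M_A G a' b') p' q' v'"
      using saddle_point_exists by blast
    have p: "p \<in> strategies a" "p \<in> strategies a'" and q': "q' \<in> strategies b'" "q' \<in> strategies b"
      using o o' less.prems strategies_mono by (auto simp: saddle_point_def)
    have "b' \<le> b" using less.prems by simp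
    \<comment> \<open>Equal bids preserve the difference in chips, so the induction hypothesis
      applies; ties can only shift in favour of \<open>A\<close>.\<close>
    have le: "M_A G a b i j \<le> M_A G a' b' i j" if "i \<le> b'" "j \<le> a" for i j
    proof (rule M_A_entry_mono)
      show "G \<in> V - {vA, vB}" using less.prems False by blast
      show "A_wins_bid a b i j \<Longrightarrow> A_wins_bid a' b' i j"
        using less.prems by (auto simp: A_wins_bid_def)
      fix G' assume G': "(G, G') \<in> red \<union> blue"
      show "v_A G' (a - j + i) (b - i + j) \<le> v_A G' (a' - j + i) (b' - i + j)"
      proof (rule less.hyps[OF card_reachable_less[OF G']])
        show "G' \<in> V" using G' red_subset blue_subset by blast
      qed (use that less.prems in auto)
    qed
    have "v \<le> expected_payoff b a (M_A G a b) p q'"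
      by (rule saddle_point_payoff_A[OF o q'(2)])
    also have "\<dots> = expected_payoff b' a (M_A G a b) p q'"
      unfolding expected_payoff_rows using \<open>b' \<le> b\<close> strategiesD(2)[OF q'(1)]
      by (intro sum.mono_neutral_right) auto
    also have "\<dots> \<le> expected_payoff b' a (M_A G a' b') p q'"
      unfolding expected_payoff_def using le strategiesD(1)[OF p(1)] strategiesD(1)[OF q'(1)]
      by (intro sum_mono mult_right_mono mult_left_mono) auto
    also have "\<dots> = expected_payoff b' a' (M_A G a' b') p q'"
      unfolding expected_payoff_cols using less.prems strategiesD(2)[OF p(1)]
      by (intro sum.mono_neutral_left) auto
    also have "\<dots> \<le> v'" by (rule saddle_point_payoff_B[OF o' p(2)])
    finally show ?thesis
      using False game_value_saddle_point[OF o] game_value_saddle_point[OF o']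
      by (simp add: v_A.simps)
  qed
qed

text \<open>The total number of chips is conserved, so a higher bid means more chips for the
  opponent and \<open>v_A_mono\<close> applies wherever the bid winner stays the same.\<close>

lemma bid_matrix_M_A:
  assumes G: "G \<in> V - {vA, vB}"
  shows "bid_matrix (if b \<le> a then 0 else 1) b a (M_A G a b)"
proof
  have move: "G' \<in> V" if "(G, G') \<in> red \<union> blue" for G'
    using that red_subset blue_subset by blast
  show "M_A G a b i j \<le> M_A G a b (Suc i) j"
    if "i < b" "j \<le> a" "j \<noteq> i + (if b \<le> a then 0 else 1)" for i j
    using that by (intro M_A_entry_mono[OF G] v_A_mono move) (auto simp: A_wins_bid_def split: if_splits)
  show "M_A G a b i (Suc j) \<le> M_A G a b i j"
    if "i \<le> b" "j < a" "Suc j \<noteq> i + (if b \<le> a then 0 else 1)" for i j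
    using that by (intro M_A_entry_mono[OF G] v_A_mono move) (auto simp: A_wins_bid_def split: if_splits)
qed simp

end

theorem theorem3p2:
  fixes V :: "'v set" and red blue :: "('v \<times> 'v) set" and vA vB G :: 'v and a b :: nat
  assumes game: "bidding_game V red blue vA vB"
    and G: "G \<in> V" "G \<noteq> vA" "G \<noteq> vB"
  shows
    "(\<forall>i\<le>b. \<forall>j\<le>a.
        ((\<lambda>x. bidding_game.M_A_adj red blue vA vB x G a b i j)
           \<longlongrightarrow> bidding_game.M_A red blue vA vB G a b i j) (at_right 0))
     \<and> ((\<lambda>x. bidding_game.v_A_adj red blue vA vB x G a b)
           \<longlongrightarrow> bidding_game.v_A red blue vA vB G a b) (at_right 0)
     \<and> (\<exists>S. nash_strategy_A b a (bidding_game.M_A red blue vA vB G a b) S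
          \<and> (\<forall>Sx. (\<forall>\<^sub>F x in at_right 0. bidding_game.is_S_A_adj red blue vA vB x G a b (Sx x))
               \<longrightarrow> (\<forall>j\<le>a. ((\<lambda>x. Sx x j) \<longlongrightarrow> S j) (at_right 0))))"
proof -
  interpret bidding_game V red blue vA vB by (rule game)
  interpret T: bid_matrix "if b \<le> a then 0 else 1" b a "M_A G a b"
    using G by (intro bid_matrix_M_A) auto
  have adj: "M_A_adj x G a b = T.adj x" for x
    by (simp add: M_A_adj_def T.adj_def fun_eq_iff)
  have "v_A G a b = game_value b a (M_A G a b)" using G by (simp add: v_A.simps)
  then show ?thesis
    using T.adj_tendsto T.maximin_payoff_tendsto T.maximin_strategy_tendsto
    unfolding v_A_adj_def is_S_A_adj_def adj by auto
qed

end
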